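(* In the Kullback–Leibler optimal control setting described in the context, consider the ordinary differential equation $$\frac{d}{d\zeta}h^\circ_\zeta=\mathcal{V}(h^\circ_\zeta),\qquad \zeta\in\mathbb{R},$$ with boundary condition $h^\circ_0\equiv0$, where $\mathcal{V}(h)=\mathcal{H}^\circ(P_h)$ and, for each irreducible and aperiodic transition matrix $P$ on $\mathsf{X}$, the function $H^\circ=\mathcal{H}^\circ(P)$ is defined by $$H^\circ(x)=\sum_{x'}\bigl[Z(x,x')-Z(x^\circ,x')\bigr]\mathcal{U}(x'),\qquad x\in\mathsf{X},$$ with $Z=[I-P+1\otimes\pi]^{-1}$ the fundamental matrix of $P$ and $\pi$ the invariant pmf of $P$. The solution to this ODE exists, and the resulting functions $\{h^\circ_\zeta:\zeta\in\mathbb{R}\}$ coincide with the relative value functions $\{h^*_\zeta:\zeta\in\mathbb{R}\}$. Consequently, $\check P_\zeta=P_{h_\zeta}$ for each $\zeta$, with $h_\zeta=h^\circ_\zeta$.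
   Context: The state space is a product of two finite sets, $\mathsf{X}=\mathsf{X}_u\times\mathsf{X}_n$, with elements $x=(x_u,x_n)$; $x^\circ\in\mathsf{X}$ is a fixed state. A matrix $Q_0(x,x_n')\ge 0$ with $\sum_{x_n'}Q_0(x,x_n')=1$ for each $x\in\mathsf{X}$ is fixed. All transition matrices $P$ considered in the optimization have the form $$P(x,x')=R(x,x_u')\,Q_0(x,x_n'),\qquad x,x'\in\mathsf{X},$$ with $R(x,x_u')\ge0$ and $\sum_{x_u'}R(x,x_u')=1$ for each $x$. The nominal transition matrix $P_0(x,x')=R_0(x,x_u')Q_0(x,x_n')$ has this form and is irreducible and aperiodic. A function $\mathcal{U}:\mathsf{X}\to\mathbb{R}$ is fixed, and $\pi(\mathcal{U})=\sum_x\pi(x)\mathcal{U}(x)$. For $P$ with invariant pmf $\pi$, $$K(P\|P_0)=\sum_{x,x'}\pi(x)P(x,x')\log\Bigl(\frac{P(x,x')}{P_0(x,x')}\Bigr)$$ (with $0\log0=0$, value $+\infty$ if $\pi(x)P(x,x')>0=P_0(x,x')$ for some $x,x'$). For each $\zeta\in\mathbb{R}$, $\check P_\zeta$ denotes the transition matrix attaining the maximum in $$\max_{\pi,P}\bigl\{\zeta\pi(\mathcal{U})-K(P\|P_0):\pi P=\pi\bigr\}$$ over pmfs $\pi$ on $\mathsf{X}$ and transition matrices $P$ of the form $P(x,x')=R(x,x_u')Q_0(x,x_n')$, with $R(x,x_u')\ge0$ and $\sum_{x_u'}R(x,x_u')=1$ for each $x$. The relative value function $h^*_\zeta:\mathsf{X}\to\mathbb{R}$,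 normalized by $h^*_\zeta(x^\circ)=0$, together with $\eta^*_\zeta\in\mathbb{R}$, is the solution to $$\max_R\Bigl\{w_\zeta(x,R)+\sum_{x'}R(x,x_u')Q_0(x,x_n')h^*_\zeta(x')\Bigr\}=h^*_\zeta(x)+\eta^*_\zeta,\qquad x\in\mathsf{X},$$ where $w_\zeta(x,R)=\zeta\,\mathcal{U}(x)-\sum_{x_u'}R(x,x_u')\log\bigl(R(x,x_u')/R_0(x,x_u')\bigr)$, with the same conventions. For $h:\mathsf{X}\to\mathbb{R}$, the transition matrix $P_h$ is $$P_h(x,x')=P_0(x,x')\exp\bigl(h(x_u'\mid x)-\Lambda_h(x)\bigr),\qquad x,x'\in\mathsf{X},$$ where $h(x_u'\mid x)=\sum_{x_n'}Q_0(x,x_n')h(x_u',x_n')$ and $\Lambda_h(x)=\log\bigl(\sum_{x'}P_0(x,x')\exp(h(x_u'\mid x))\bigr)$. The matrix $1\otimes\pi$ has each row equal to $\pi$. *)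

theory Defs
  imports "HOL-Analysis.Analysis"
begin

text \<open>
  The state space is the product type \<open>'u \<times> 'n\<close> of two finite types. Functions on it are
  vectors, and transition matrices are matrices acting on row vectors from the right
  (\<open>P $ x $ x'\<close> is the probability of moving from \<open>x\<close> to \<open>x'\<close>).
\<close>

definition prob_vec :: "real ^ 'a \<Rightarrow> bool" where
  "prob_vec \<pi> \<longleftrightarrow> (\<forall>x. 0 \<le> \<pi> $ x) \<and> (\<Sum>x\<in>UNIV. \<pi> $ x) = 1"

text \<open>Possibly rectangular, so that it applies to \<open>R\<close> and \<open>Q\<^sub>0\<close> as well as to \<open>P\<close>.\<close>

definition stochastic :: "real ^ 'b ^ 'a \<Rightarrow> bool" where
  "stochastic M \<longleftrightarrow> (\<forall>x. prob_vec (M $ x))"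

definition mat_pow :: "real ^ 'a ^ 'a \<Rightarrow> nat \<Rightarrow> real ^ 'a ^ 'a" where
  "mat_pow P k = (((**) P) ^^ k) (mat 1)"

definition irreducible_matrix :: "real ^ 'a ^ 'a \<Rightarrow> bool" where
  "irreducible_matrix P \<longleftrightarrow> (\<forall>x y. \<exists>k. mat_pow P k $ x $ y > 0)"

definition aperiodic_matrix :: "real ^ 'a ^ 'a \<Rightarrow> bool" where
  "aperiodic_matrix P \<longleftrightarrow> (\<forall>x. Gcd {k. 0 < k \<and> mat_pow P k $ x $ x > 0} = 1)"

definition invariant :: "real ^ 'a ^ 'a \<Rightarrow> real ^ 'a \<Rightarrow> bool" where
  "invariant P \<pi> \<longleftrightarrow> prob_vec \<pi> \<and> \<pi> v* P = \<pi>"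

text \<open>The description operator is meaningful for irreducible stochastic \<open>P\<close>.\<close>

definition invariant_pmf :: "real ^ 'a ^ 'a \<Rightarrow> real ^ 'a" where
  "invariant_pmf P = (THE \<pi>. invariant P \<pi>)"

definition fundamental_matrix :: "real ^ 'a ^ 'a \<Rightarrow> real ^ 'a ^ 'a" where
  "fundamental_matrix P = matrix_inv (mat 1 - P + (\<chi> x x'. invariant_pmf P $ x'))"

text \<open>The function \<open>\<H>\<^sup>\<circ>(P)\<close>.\<close>

definition H_op :: "real ^ 'a \<Rightarrow> 'a \<Rightarrow> real ^ 'a ^ 'a \<Rightarrow> real ^ 'a" where
  "H_op U x0 P =
     (let Z = fundamental_matrix P
      in (\<chi> x. \<Sum>x'\<in>UNIV. (Z $ x $ x' - Z $ x0 $ x') * U $ x'))"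

definition controlled :: "real ^ 'u ^ ('u::finite \<times> 'n::finite) \<Rightarrow> real ^ 'n ^ ('u \<times> 'n)
    \<Rightarrow> real ^ ('u \<times> 'n) ^ ('u \<times> 'n)" where
  "controlled R Q0 = (\<chi> x x'. R $ x $ fst x' * Q0 $ x $ snd x')"

text \<open>
  In the next two definitions the convention \<open>0 log 0 = 0\<close> needs no case distinction, because
  \<open>ln 0 = 0\<close> and every logarithm is multiplied by the vanishing factor; only infinite values do.
\<close>

definition KL_rate :: "real ^ 'a \<Rightarrow> real ^ 'a ^ 'a \<Rightarrow> real ^ 'a ^ 'a \<Rightarrow> ereal" where
  "KL_rate \<pi> P P0 =
     (if \<exists>x x'. \<pi> $ x * P $ x $ x' > 0 \<and> P0 $ x $ x' = 0 then \<infinity>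
      else ereal (\<Sum>x\<in>UNIV. \<Sum>x'\<in>UNIV. \<pi> $ x * P $ x $ x' * ln (P $ x $ x' / P0 $ x $ x')))"

definition reward :: "real ^ 'u ^ ('u::finite \<times> 'n::finite) \<Rightarrow> real ^ ('u \<times> 'n) \<Rightarrow> real
    \<Rightarrow> 'u \<times> 'n \<Rightarrow> real ^ 'u ^ ('u \<times> 'n) \<Rightarrow> ereal" where
  "reward R0 U \<zeta> x R =
     (if \<exists>u. R $ x $ u > 0 \<and> R0 $ x $ u = 0 then - \<infinity>
      else ereal (\<zeta> * U $ x - (\<Sum>u\<in>UNIV. R $ x $ u * ln (R $ x $ u / R0 $ x $ u))))"

text \<open>\<open>P\<close> is the matrix component of a maximiser of \<open>\<zeta> \<pi>(U) - K(P\<parallel>P\<^sub>0)\<close>.\<close>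

definition optimal_matrix :: "real ^ 'n ^ ('u::finite \<times> 'n::finite) \<Rightarrow> real ^ ('u \<times> 'n) ^ ('u \<times> 'n)
    \<Rightarrow> real ^ ('u \<times> 'n) \<Rightarrow> real \<Rightarrow> real ^ ('u \<times> 'n) ^ ('u \<times> 'n) \<Rightarrow> bool" where
  "optimal_matrix Q0 P0 U \<zeta> P \<longleftrightarrow>
     (\<exists>\<pi>. is_arg_max
        (\<lambda>(\<pi>, P). ereal (\<zeta> * (\<Sum>x\<in>UNIV. \<pi> $ x * U $ x)) - KL_rate \<pi> P P0)
        (\<lambda>(\<pi>, P). (\<exists>R. stochastic R \<and> P = controlled R Q0) \<and> invariant P \<pi>)
        (\<pi>, P))"

text \<open>The pair \<open>(h, \<eta>)\<close> solves the dynamic programming equation, the maximum being attained.\<close>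

definition relative_value :: "real ^ 'u ^ ('u::finite \<times> 'n::finite) \<Rightarrow> real ^ 'n ^ ('u \<times> 'n)
    \<Rightarrow> real ^ ('u \<times> 'n) \<Rightarrow> 'u \<times> 'n \<Rightarrow> real \<Rightarrow> real ^ ('u \<times> 'n) \<Rightarrow> real \<Rightarrow> bool" where
  "relative_value R0 Q0 U x0 \<zeta> h \<eta> \<longleftrightarrow>
     h $ x0 = 0 \<and>
     (\<forall>x. let f = (\<lambda>R. reward R0 U \<zeta> x R
                    + ereal (\<Sum>x'\<in>UNIV. R $ x $ fst x' * Q0 $ x $ snd x' * h $ x'))
          in \<exists>R. is_arg_max f stochastic R \<and> f R = ereal (h $ x + \<eta>))"

definition cond_mean :: "real ^ 'n ^ ('u::finite \<times> 'n::finite) \<Rightarrow> real ^ ('u \<times> 'n)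
    \<Rightarrow> 'u \<times> 'n \<Rightarrow> 'u \<Rightarrow> real" where
  "cond_mean Q0 h x u = (\<Sum>n\<in>UNIV. Q0 $ x $ n * h $ (u, n))"

definition log_norm :: "real ^ 'n ^ ('u::finite \<times> 'n::finite) \<Rightarrow> real ^ ('u \<times> 'n) ^ ('u \<times> 'n)
    \<Rightarrow> real ^ ('u \<times> 'n) \<Rightarrow> 'u \<times> 'n \<Rightarrow> real" where
  "log_norm Q0 P0 h x = ln (\<Sum>x'\<in>UNIV. P0 $ x $ x' * exp (cond_mean Q0 h x (fst x')))"

definition tilted :: "real ^ 'n ^ ('u::finite \<times> 'n::finite) \<Rightarrow> real ^ ('u \<times> 'n) ^ ('u \<times> 'n)
    \<Rightarrow> real ^ ('u \<times> 'n) \<Rightarrow> real ^ ('u \<times> 'n) ^ ('u \<times> 'n)" where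
  "tilted Q0 P0 h =
     (\<chi> x x'. P0 $ x $ x' * exp (cond_mean Q0 h x (fst x') - log_norm Q0 P0 h x))"

definition ode_solution :: "real ^ 'n ^ ('u::finite \<times> 'n::finite) \<Rightarrow> real ^ ('u \<times> 'n) ^ ('u \<times> 'n)
    \<Rightarrow> real ^ ('u \<times> 'n) \<Rightarrow> 'u \<times> 'n \<Rightarrow> (real \<Rightarrow> real ^ ('u \<times> 'n)) \<Rightarrow> bool" where
  "ode_solution Q0 P0 U x0 h \<longleftrightarrow>
     h 0 = 0 \<and>
     (\<forall>\<zeta>. (h has_vector_derivative H_op U x0 (tilted Q0 P0 (h \<zeta>))) (at \<zeta>))"

end

theory Submission
  imports Defs
begin

text \<open>
  The normaliser \<open>\<Lambda>\<^sub>h\<close> is convex in \<open>h\<close> with derivative \<open>P\<^sub>h\<close>, and the dynamic programming equation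
  reads \<open>h - \<Lambda>\<^sub>h + \<eta> = \<zeta> U\<close>. Convexity and the maximum principle for \<open>P\<^sub>h\<close> make the map
  \<open>(h, \<eta>) \<mapsto> h - \<Lambda>\<^sub>h + \<eta>\<close> injective on \<open>{h. h(x\<^sup>\<circ>) = 0} \<times> \<real>\<close>. It is open by invariance of domain and
  has closed range because \<open>\<Lambda>\<^sub>h \<ge> P\<^sub>0 h\<close> bounds \<open>(h, \<eta>)\<close> by its image, so it is a bijection. Its
  derivative is inverted by the fundamental matrix of \<open>P\<^sub>h\<close>, so differentiating the inverse along
  \<open>\<zeta> \<mapsto> \<zeta> U\<close> gives a global solution of the ODE. Conversely, along any solution Poisson's equation
  makes the derivative of \<open>\<Lambda>\<^sub>h - h + \<zeta> U\<close> a constant function on the state space, so the solution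
  satisfies the dynamic programming equation. Optimality holds because the objective equals \<open>\<eta>\<close> minus
  a relative entropy of \<open>P\<close> with respect to \<open>P\<^sub>h\<close>.
\<close>

section \<open>Irreducible stochastic matrices\<close>

lemma prob_vec_nonneg: "prob_vec p \<Longrightarrow> 0 \<le> p $ x"
  by (simp add: prob_vec_def)

lemma prob_vec_inner_one: "prob_vec p \<Longrightarrow> p \<bullet> 1 = 1"
  by (simp add: prob_vec_def inner_vec_def)

lemma prob_vec_inner_mono: "prob_vec p \<Longrightarrow> f \<le> g \<Longrightarrow> p \<bullet> f \<le> p \<bullet> g"
  by (auto simp: prob_vec_def inner_vec_def less_eq_vec_def intro!: sum_mono mult_left_mono)

lemma prob_vec_inner_le_norm:
  assumes "prob_vec p"
  shows "\<bar>p \<bullet> f\<bar> \<le> norm f"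
proof -
  have *: "p \<bullet> g \<le> norm g" for g
  proof -
    have "g \<le> norm g *\<^sub>R 1"
      using component_le_norm_cart[of g] by (auto simp: less_eq_vec_def intro: order_trans[OF abs_ge_self])
    from prob_vec_inner_mono[OF assms this] show ?thesis
      by (simp add: prob_vec_inner_one[OF assms])
  qed
  show ?thesis
    using *[of f] *[of "- f"] by simp
qed

lemma stochasticD: "stochastic M \<Longrightarrow> prob_vec (M $ x)"
  by (simp add: stochastic_def)

lemma stochastic_nonneg: "stochastic M \<Longrightarrow> 0 \<le> M $ x $ y"
  and stochastic_sum: "stochastic M \<Longrightarrow> (\<Sum>y\<in>UNIV. M $ x $ y) = 1"
  using stochasticD by (auto simp: prob_vec_def)

lemma stochastic_mult_const: "stochastic P \<Longrightarrow> P *v (c *\<^sub>R 1) = c *\<^sub>R 1"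
  by (simp add: stochastic_def prob_vec_def vec_eq_iff matrix_vector_mult_def sum_distrib_right[symmetric])

lemma stochastic_mult_mono: "stochastic P \<Longrightarrow> f \<le> g \<Longrightarrow> P *v f \<le> P *v g"
  by (auto simp: stochastic_def prob_vec_def less_eq_vec_def matrix_vector_mult_def
      intro!: sum_mono mult_left_mono)

lemma mat_pow_0: "mat_pow P 0 = mat 1"
  and mat_pow_Suc: "mat_pow P (Suc k) = P ** mat_pow P k"
  by (simp_all add: mat_pow_def)

lemma mat_pow_nonneg:
  assumes "\<And>x y. 0 \<le> P $ x $ y"
  shows "0 \<le> mat_pow P k $ x $ y"
  by (induction k arbitrary: x)
     (auto simp: mat_pow_0 mat_pow_Suc mat_def matrix_matrix_mult_def assms intro!: sum_nonneg)

text \<open>A positive entry of a power of \<open>P\<close> has a positive summand, and by induction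
  the same path is open for \<open>Q\<close>. This transfers irreducibility from \<open>P0\<close>
  to every tilted matrix.\<close>

lemma irreducible_matrix_mono_support:
  assumes irr: "irreducible_matrix P"
    and P: "\<And>x y. 0 \<le> P $ x $ y" and Q: "\<And>x y. 0 \<le> Q $ x $ y"
    and supp: "\<And>x y. 0 < P $ x $ y \<Longrightarrow> 0 < Q $ x $ y"
  shows "irreducible_matrix Q"
proof -
  have "0 < mat_pow P k $ x $ y \<Longrightarrow> 0 < mat_pow Q k $ x $ y" for k x y
  proof (induction k arbitrary: x)
    case (Suc k)
    have "\<exists>z. 0 < P $ x $ z * mat_pow P k $ z $ y"
    proof (rule ccontr)
      assume "\<not> ?thesis"
      then have "(\<Sum>z\<in>UNIV. P $ x $ z * mat_pow P k $ z $ y) \<le> 0"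
        by (intro sum_nonpos) (auto simp: not_less)
      with Suc.prems show False
        by (simp add: mat_pow_Suc matrix_matrix_mult_def)
    qed
    then obtain z where "0 < P $ x $ z" "0 < mat_pow P k $ z $ y"
      using P mat_pow_nonneg[OF P] by (metis less_le mult_zero_left mult_zero_right)
    then have "0 < Q $ x $ z * mat_pow Q k $ z $ y"
      using supp Suc.IH by simp
    also have "\<dots> \<le> (\<Sum>z\<in>UNIV. Q $ x $ z * mat_pow Q k $ z $ y)"
      using Q mat_pow_nonneg[OF Q] by (intro member_le_sum) auto
    finally show ?case
      by (simp add: mat_pow_Suc matrix_matrix_mult_def)
  qed (simp add: mat_pow_0)
  then show ?thesis
    using irr unfolding irreducible_matrix_def by blast
qed

lemma stochastic_mat_pow:
  assumes "stochastic P"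
  shows "stochastic (mat_pow P k)"
proof -
  have nn: "0 \<le> P $ x $ y" for x y
    using assms by (auto simp: stochastic_def prob_vec_def)
  have "mat_pow P k *v 1 = 1"
    using stochastic_mult_const[OF assms, of 1]
    by (induction k) (simp_all add: mat_pow_0 mat_pow_Suc flip: matrix_vector_mul_assoc)
  then show ?thesis
    using mat_pow_nonneg[OF nn]
    by (simp add: stochastic_def prob_vec_def vec_eq_iff matrix_vector_mult_def)
qed

text \<open>A maximum of a subharmonic function propagates along \<open>P\<close>, hence everywhere.\<close>

lemma subharmonic_const:
  fixes g :: "real ^ 'a"
  assumes P: "stochastic P" "irreducible_matrix P" and sub: "g \<le> P *v g"
  shows "g $ x = g $ y"
proof -
  define M where "M = Max (range (($) g))"
  have le: "g $ z \<le> M" for z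
    by (simp add: M_def)
  obtain a where a: "g $ a = M"
    using Max_in[of "range (($) g)"] unfolding M_def by (metis finite_imageI finite rangeE UNIV_not_empty image_is_empty)
  have "g $ z = M" for z
  proof -
    obtain k where k: "0 < mat_pow P k $ a $ z"
      using P(2) by (auto simp: irreducible_matrix_def)
    have "g \<le> mat_pow P k *v g"
    proof (induction k)
      case (Suc k)
      show ?case
        using sub stochastic_mult_mono[OF P(1) Suc]
        by (simp add: mat_pow_Suc flip: matrix_vector_mul_assoc)
    qed (simp add: mat_pow_0)
    then have "M \<le> (\<Sum>b\<in>UNIV. mat_pow P k $ a $ b * g $ b)"
      using a by (auto simp: less_eq_vec_def matrix_vector_mult_def)
    moreover have pv: "\<And>b. 0 \<le> mat_pow P k $ a $ b" "(\<Sum>b\<in>UNIV. mat_pow P k $ a $ b) = 1"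
      using stochastic_mat_pow[OF P(1)] by (auto simp: stochastic_def prob_vec_def)
    \<comment> \<open>The gaps \<open>M - g $ b\<close> are nonnegative while their weighted sum is
      at most 0, so the gap at \<open>z\<close>, which has positive weight, must vanish.\<close>
    ultimately have "(\<Sum>b\<in>UNIV. mat_pow P k $ a $ b * (M - g $ b)) \<le> 0"
      by (simp add: right_diff_distrib sum_subtractf flip: sum_distrib_right)
    moreover have "mat_pow P k $ a $ z * (M - g $ z) \<le> (\<Sum>b\<in>UNIV. mat_pow P k $ a $ b * (M - g $ b))"
      using pv le by (intro member_le_sum) auto
    ultimately have "M - g $ z \<le> 0"
      using k by (metis mult_pos_pos not_le order_trans)
    with le[of z] show ?thesis by simp
  qed
  then show ?thesis by simp
qed

section \<open>Existence and positivity of invariant pmfs\<close>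

lemma inner_invariant: "invariant P p \<Longrightarrow> p \<bullet> (P *v f) = p \<bullet> f"
  by (metis invariant_def dot_lmul_matrix)

text \<open>The vector \<open>v\<close> has mass at some \<open>x\<close> and is fixed by all powers
  of \<open>P\<close>, one of which carries that mass to \<open>y\<close>.\<close>

lemma fixed_row_pos:
  assumes P: "stochastic P" "irreducible_matrix P"
    and v: "\<And>x. 0 \<le> v $ x" "v v* P = v" "v \<noteq> 0"
  shows "0 < v $ y"
proof -
  obtain x where x: "0 < v $ x"
    using v by (metis less_le vec_eq_iff zero_index)
  obtain k where k: "0 < mat_pow P k $ x $ y"
    using P(2) by (auto simp: irreducible_matrix_def)
  have "v v* mat_pow P k = v"
    by (induction k) (simp_all add: mat_pow_0 mat_pow_Suc v flip: vector_matrix_mul_assoc)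
  then have "v $ y = (\<Sum>z\<in>UNIV. v $ z * mat_pow P k $ z $ y)"
    by (auto simp: vector_matrix_mult_def vec_eq_iff)
  moreover have "v $ x * mat_pow P k $ x $ y \<le> (\<Sum>z\<in>UNIV. v $ z * mat_pow P k $ z $ y)"
    using v(1) stochastic_mat_pow[OF P(1)]
    by (intro member_le_sum) (auto simp: stochastic_def prob_vec_def)
  ultimately show ?thesis
    using x k by (metis mult_pos_pos less_le_trans)
qed

lemma invariant_pos:
  assumes "stochastic P" "irreducible_matrix P" "invariant P p"
  shows "0 < p $ x"
proof (rule fixed_row_pos[OF assms(1,2)])
  show "p \<noteq> 0" "p v* P = p" "\<And>x. 0 \<le> p $ x"
    using assms(3) by (auto simp: invariant_def prob_vec_def)
qed

text \<open>Since \<open>P - mat 1\<close> kills the constants it is singular, so it also has a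
  nonzero left null vector \<open>v\<close>. The absolute value of \<open>v\<close> can only grow
  under \<open>P\<close>, but \<open>P\<close> preserves total mass, so it is fixed and can be
  normalised.\<close>

lemma invariant_exists:
  fixes P :: "real ^ 'a ^ 'a"
  assumes P: "stochastic P"
  shows "\<exists>p. invariant P p"
proof -
  have nn: "0 \<le> P $ x $ y" for x y
    using P by (auto simp: stochastic_def prob_vec_def)
  have one: "(P - mat 1) *v 1 = 0"
    using stochastic_mult_const[OF P, of 1] by (simp add: matrix_vector_mult_diff_rdistrib)
  have "\<exists>v. v \<noteq> 0 \<and> transpose (P - mat 1) *v v = 0"
  proof (rule ccontr)
    assume "\<not> ?thesis"
    then obtain B where "B ** transpose (P - mat 1) = mat 1"
      using matrix_left_invertible_ker[of "transpose (P - mat 1)"] by blast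
    then have "(P - mat 1) ** transpose B = mat 1"
      by (metis matrix_transpose_mul transpose_mat transpose_transpose)
    then have "transpose B ** (P - mat 1) = mat 1"
      by (simp add: matrix_left_right_inverse)
    then show False
      using one by (metis matrix_left_invertible_ker zero_neq_one)
  qed
  then obtain v where v: "v \<noteq> 0" "transpose (P - mat 1) *v v = 0"
    by blast
  then have "v v* (P - mat 1) = 0"
    by simp
  then have vP: "v v* P = v"
    by (simp add: vector_matrix_mult_diff_rdistrib)
  define w where "w = (\<chi> x. \<bar>v $ x\<bar>)"
  have "w \<le> w v* P"
    unfolding less_eq_vec_def
  proof
    fix y
    have "\<bar>v $ y\<bar> = \<bar>\<Sum>x\<in>UNIV. P $ x $ y * v $ x\<bar>"
      by (subst vP[symmetric]) (simp add: vector_matrix_mult_def mult.commute)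
    also have "\<dots> \<le> (\<Sum>x\<in>UNIV. \<bar>P $ x $ y * v $ x\<bar>)"
      by (rule sum_abs)
    finally show "w $ y \<le> (w v* P) $ y"
      by (simp add: w_def vector_matrix_mult_def abs_mult nn mult.commute)
  qed
  then have ge: "0 \<le> (w v* P - w) $ y" for y
    by (simp add: less_eq_vec_def)
  have "(w v* P - w) \<bullet> 1 = 0"
    using stochastic_mult_const[OF P, of 1] by (simp add: inner_diff_left dot_lmul_matrix)
  then have "(w v* P - w) $ y = 0" for y
    using ge by (simp add: inner_vec_def sum_nonneg_eq_0_iff del: vector_minus_component)
  then have wP: "w v* P = w"
    by (simp add: vec_eq_iff)
  obtain x where "v $ x \<noteq> 0"
    using v(1) by (auto simp: vec_eq_iff)
  then have s: "0 < (\<Sum>x\<in>UNIV. w $ x)"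
    by (intro sum_pos2[of _ x]) (auto simp: w_def)
  define p where "p = (1 / (\<Sum>x\<in>UNIV. w $ x)) *\<^sub>R w"
  have "prob_vec p"
    using s unfolding prob_vec_def p_def by (auto simp: w_def simp flip: sum_divide_distrib)
  moreover have "p v* P = p"
    unfolding p_def using wP by (metis scaleR_vector_matrix_assoc)
  ultimately show ?thesis
    unfolding invariant_def by blast
qed

section \<open>Poisson's equation and the fundamental matrix\<close>

lemma vec_const_eq: "(\<And>x y. g $ x = g $ y) \<Longrightarrow> g = (g $ a) *\<^sub>R (1 :: real ^ 'a)"
  by (auto simp: vec_eq_iff)

lemma fundamental_inverse_mult:
  "(mat 1 - P + (\<chi> x y. p $ y)) *v g = g - P *v g + (p \<bullet> g) *\<^sub>R (1 :: real ^ 'a)"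
  by (simp add: matrix_vector_mult_diff_rdistrib matrix_vector_mult_add_rdistrib)
     (simp add: vec_eq_iff matrix_vector_mult_def inner_vec_def)

text \<open>Averaging over an invariant pmf cancels \<open>g - P *v g\<close> and leaves
  \<open>c = 0\<close>; then \<open>g\<close> is harmonic, hence constant. This computes the kernels
  behind both the fundamental matrix and the linearised dynamic programming map.\<close>

lemma Poisson_unique:
  fixes g :: "real ^ 'a"
  assumes P: "stochastic P" "irreducible_matrix P" and g: "g - P *v g + c *\<^sub>R 1 = 0"
  shows "c = 0 \<and> g = (g $ a) *\<^sub>R 1"
proof -
  obtain p where p: "invariant P p"
    using invariant_exists[OF P(1)] by blast
  then have "p \<bullet> 1 = 1"
    by (simp add: invariant_def prob_vec_inner_one)
  then have "p \<bullet> (g - P *v g + c *\<^sub>R 1) = c"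
    by (simp add: inner_add_right inner_diff_right inner_invariant[OF p])
  then have c: "c = 0"
    using g by simp
  then have "g = P *v g"
    using g by simp
  then have "g $ x = g $ y" for x y
    using subharmonic_const[OF P] by simp
  then show ?thesis
    using c vec_const_eq[of g a] by blast
qed

lemma fundamental_matrix_invertible:
  fixes P :: "real ^ 'a ^ 'a"
  assumes P: "stochastic P" "irreducible_matrix P" and p: "invariant P p"
  shows "invertible (mat 1 - P + (\<chi> x y. p $ y))"
proof -
  have "g = 0" if g: "g - P *v g + (p \<bullet> g) *\<^sub>R 1 = 0" for g
  proof -
    have "p \<bullet> g = 0" "g = (g $ undefined) *\<^sub>R 1"
      using Poisson_unique[OF P g, of undefined] by auto
    moreover have "p \<bullet> 1 = 1"
      using p by (simp add: invariant_def prob_vec_inner_one)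
    ultimately show ?thesis
      by (metis inner_scaleR_right mult.right_neutral scaleR_zero_left)
  qed
  then show ?thesis
    unfolding invertible_left_inverse matrix_left_invertible_ker fundamental_inverse_mult by blast
qed

text \<open>Invertibility of the matrix built from \<open>p\<close> writes any \<open>f\<close> as
  \<open>g - P *v g\<close> plus the constant \<open>p \<bullet> g\<close>. Every invariant pmf
  therefore gives \<open>f\<close> the same mean.\<close>

lemma invariant_unique:
  fixes P :: "real ^ 'a ^ 'a"
  assumes P: "stochastic P" "irreducible_matrix P" and p: "invariant P p" and q: "invariant P q"
  shows "p = q"
proof (rule vector_eq_rdot[THEN iffD1, rule_format])
  fix f :: "real ^ 'a"
  obtain B where "(mat 1 - P + (\<chi> x y. p $ y)) ** B = mat 1"
    using fundamental_matrix_invertible[OF P p] unfolding invertible_def by blast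
  then have "f = (mat 1 - P + (\<chi> x y. p $ y)) *v (B *v f)"
    by (simp add: matrix_vector_mul_assoc)
  then have f: "f = B *v f - P *v (B *v f) + (p \<bullet> (B *v f)) *\<^sub>R 1"
    by (simp only: fundamental_inverse_mult)
  have "r \<bullet> f = p \<bullet> (B *v f)" if "invariant P r" for r
  proof -
    have "r \<bullet> 1 = 1"
      using that by (simp add: invariant_def prob_vec_inner_one)
    then show ?thesis
      by (subst f) (simp add: inner_add_right inner_diff_right inner_invariant[OF that])
  qed
  then show "p \<bullet> f = q \<bullet> f"
    using p q by simp
qed

lemma invariant_invariant_pmf:
  fixes P :: "real ^ 'a ^ 'a"
  assumes "stochastic P" "irreducible_matrix P"
  shows "invariant P (invariant_pmf P)"
  unfolding invariant_pmf_def
  using invariant_exists[OF assms(1)] invariant_unique[OF assms] by (metis theI')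

lemma H_op_base: "H_op U x0 P $ x0 = 0"
  by (simp add: H_op_def Let_def)

text \<open>\<open>H_op\<close> is the fundamental matrix applied to \<open>U\<close>, shifted by a
  constant so as to vanish at \<open>x0\<close>. Shifts are invisible to the left side, and
  averaging over the invariant pmf identifies the constant on the right.\<close>

lemma H_op_Poisson:
  fixes P :: "real ^ 'a ^ 'a"
  assumes P: "stochastic P" "irreducible_matrix P"
  shows "H_op U x0 P - P *v H_op U x0 P = U - (invariant_pmf P \<bullet> U) *\<^sub>R 1"
proof -
  let ?p = "invariant_pmf P" and ?Z = "fundamental_matrix P"
  have p: "invariant P ?p"
    by (rule invariant_invariant_pmf[OF P])
  then have pv: "?p \<bullet> 1 = 1"
    by (simp add: invariant_def prob_vec_inner_one)
  have "(mat 1 - P + (\<chi> x y. ?p $ y)) ** ?Z = mat 1"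
    unfolding fundamental_matrix_def
    by (rule someI2_ex[OF fundamental_matrix_invertible[OF P p, unfolded invertible_def], folded matrix_inv_def]) simp
  then have "U = (mat 1 - P + (\<chi> x y. ?p $ y)) *v (?Z *v U)"
    by (simp add: matrix_vector_mul_assoc)
  then have "U = ?Z *v U - P *v (?Z *v U) + (?p \<bullet> (?Z *v U)) *\<^sub>R 1"
    by (simp only: fundamental_inverse_mult)
  then have Z: "?Z *v U - P *v (?Z *v U) = U - (?p \<bullet> (?Z *v U)) *\<^sub>R 1"
    by (simp add: eq_diff_eq)
  then have "?p \<bullet> (?Z *v U - P *v (?Z *v U)) = ?p \<bullet> (U - (?p \<bullet> (?Z *v U)) *\<^sub>R 1)"
    by simp
  then have pZ: "?p \<bullet> (?Z *v U) = ?p \<bullet> U"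
    by (simp add: inner_diff_right inner_invariant[OF p] pv)
  have "H_op U x0 P = ?Z *v U - ((?Z *v U) $ x0) *\<^sub>R 1"
    by (simp add: H_op_def Let_def vec_eq_iff matrix_vector_mult_def left_diff_distrib sum_subtractf)
  then show ?thesis
    using Z pZ by (simp add: matrix_vector_mult_diff_distrib stochastic_mult_const[OF P(1)])
qed

section \<open>Relative entropy\<close>

text \<open>Real-valued, unlike \<open>KL_rate\<close>: where \<open>q\<close> vanishes and
  \<open>p\<close> does not, the term is 0 by the defaults for division and \<open>ln\<close>, not
  infinite. Results on it therefore assume absolute continuity, except when both arguments
  agree.\<close>

definition KL_div :: "real ^ 'a \<Rightarrow> real ^ 'a \<Rightarrow> real" where
  "KL_div p q = (\<Sum>i\<in>UNIV. p $ i * ln (p $ i / q $ i))"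

lemma KL_div_term:
  fixes p q :: real
  assumes "0 \<le> p" "0 \<le> q" "0 < p \<Longrightarrow> 0 < q"
  shows "p - q \<le> p * ln (p / q)" "p * ln (p / q) = p - q \<Longrightarrow> p = q"
proof -
  have *: "p * ln (p / q) = p - q + p * (q / p - 1 - ln (q / p))" if "0 < p"
    using that assms(3) by (simp add: ln_div algebra_simps)
  show "p - q \<le> p * ln (p / q)"
  proof (cases "p = 0")
    case False
    then have "0 \<le> p * (q / p - 1 - ln (q / p))"
      using assms ln_le_minus_one[of "q / p"] by simp
    with False show ?thesis
      using assms * by linarith
  qed (use assms in simp)
  show "p = q" if eq: "p * ln (p / q) = p - q"
  proof (cases "p = 0")
    case False
    then have "ln (q / p) = q / p - 1"
      using assms * eq by simp
    then have "q / p = 1"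
      using ln_eq_minus_one[of "q / p"] assms False by simp
    with False show ?thesis by simp
  qed (use eq in simp)
qed

text \<open>Gibbs' inequality. Subtracting \<open>p $ i - q $ i\<close> from each term leaves the
  sum unchanged, since both vectors have mass one, and makes every term nonnegative.\<close>

lemma
  assumes p: "prob_vec p" and q: "prob_vec q" and ac: "\<And>i. 0 < p $ i \<Longrightarrow> 0 < q $ i"
  shows KL_div_nonneg: "0 \<le> KL_div p q"
    and KL_div_eq_0_imp: "KL_div p q = 0 \<Longrightarrow> p = q"
proof -
  have *: "KL_div p q = (\<Sum>i\<in>UNIV. p $ i * ln (p $ i / q $ i) - (p $ i - q $ i))"
    using p q by (simp add: KL_div_def prob_vec_def sum_subtractf)
  have nn: "0 \<le> p $ i * ln (p $ i / q $ i) - (p $ i - q $ i)" for i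
    using KL_div_term(1)[of "p $ i" "q $ i"] p q ac by (simp add: prob_vec_def)
  then show "0 \<le> KL_div p q"
    unfolding * by (intro sum_nonneg) simp
  show "p = q" if "KL_div p q = 0"
  proof -
    have "p $ i * ln (p $ i / q $ i) - (p $ i - q $ i) = 0" for i
      using that nn unfolding * by (subst (asm) sum_nonneg_eq_0_iff) auto
    then have "p $ i = q $ i" for i
      using KL_div_term(2)[of "p $ i" "q $ i"] p q ac by (simp add: prob_vec_def)
    then show ?thesis
      by (simp add: vec_eq_iff)
  qed
qed

lemma KL_div_self: "KL_div p p = 0"
  unfolding KL_div_def by (intro sum.neutral ballI) (metis div_self ln_one mult_eq_0_iff)

text \<open>Change of reference vector under an exponential tilt. It is applied to rows of
  \<open>R0\<close> for the dynamic programming equation and to rows of \<open>P0\<close> for the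
  long-run objective.\<close>

lemma KL_div_tilt:
  assumes p: "prob_vec p" and ac: "\<And>i. 0 < p $ i \<Longrightarrow> 0 < q $ i"
  shows "KL_div p q = KL_div p (\<chi> i. q $ i * exp (f i - L)) + (\<Sum>i\<in>UNIV. p $ i * f i) - L"
proof -
  have "p $ i * ln (p $ i / q $ i) = p $ i * ln (p $ i / (q $ i * exp (f i - L))) + p $ i * f i - L * p $ i" for i
  proof (cases "p $ i = 0")
    case False
    then have "0 < p $ i" "0 < q $ i"
      using p ac by (auto simp: prob_vec_def less_le)
    then show ?thesis
      by (simp add: ln_div ln_mult algebra_simps)
  qed simp
  then show ?thesis
    using p by (simp add: KL_div_def prob_vec_def sum.distrib sum_subtractf flip: sum_distrib_left)
qed

lemma sum_controlled_fst:
  assumes "stochastic Q0"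
  shows "(\<Sum>y\<in>UNIV. controlled R Q0 $ x $ y * f (fst y)) = (\<Sum>u\<in>UNIV. R $ x $ u * f u)"
proof -
  have "(\<Sum>y\<in>UNIV. controlled R Q0 $ x $ y * f (fst y))
      = (\<Sum>u\<in>UNIV. \<Sum>n\<in>UNIV. (R $ x $ u * f u) * Q0 $ x $ n)"
    unfolding UNIV_Times_UNIV[symmetric] sum.cartesian_product
    by (intro sum.cong) (auto simp: controlled_def)
  also have "\<dots> = (\<Sum>u\<in>UNIV. R $ x $ u * f u)"
    by (simp add: stochastic_sum[OF assms] flip: sum_distrib_left)
  finally show ?thesis .
qed

lemma controlled_mult:
  "(controlled R Q0 *v h) $ x = (\<Sum>u\<in>UNIV. R $ x $ u * cond_mean Q0 h x u)"
proof -
  have "(controlled R Q0 *v h) $ x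
      = (\<Sum>u\<in>UNIV. \<Sum>n\<in>UNIV. R $ x $ u * (Q0 $ x $ n * h $ (u, n)))"
    unfolding matrix_vector_mult_def vec_lambda_beta UNIV_Times_UNIV[symmetric] sum.cartesian_product
    by (intro sum.cong) (auto simp: controlled_def)
  then show ?thesis
    by (simp add: cond_mean_def sum_distrib_left)
qed

lemma stochastic_controlled:
  assumes "stochastic R" "stochastic Q0"
  shows "stochastic (controlled R Q0)"
  using sum_controlled_fst[OF assms(2), where f = "\<lambda>_. 1" and R = R] assms
  by (simp add: stochastic_def prob_vec_def) (simp add: controlled_def)

text \<open>The linear projection onto functions vanishing at \<open>a\<close>. It recovers the
  value function from a vector whose entry at \<open>a\<close> stores the eigenvalue.\<close>

definition zero_at :: "'a \<Rightarrow> real ^ 'a \<Rightarrow> real ^ 'a" where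
  "zero_at a z = (\<chi> x. if x = a then 0 else z $ x)"

lemma zero_at_nth: "zero_at a z $ x = (if x = a then 0 else z $ x)"
  by (simp add: zero_at_def)

lemma linear_zero_at: "linear (zero_at a)"
  by (rule linearI) (simp_all add: zero_at_def vec_eq_iff)

lemma has_derivative_zero_at: "(zero_at a has_derivative zero_at a) (at z)"
  using linear_zero_at by (intro bounded_linear_imp_has_derivative) (simp add: linear_conv_bounded_linear)

lemma zero_at_eqD: "zero_at a z = zero_at a w \<Longrightarrow> z $ a = w $ a \<Longrightarrow> z = w"
  by (auto simp: zero_at_def vec_eq_iff split: if_splits)

section \<open>The dynamic programming equation\<close>

locale kl_control =
  fixes R0 :: "real ^ 'u::finite ^ ('u \<times> 'n::finite)"
    and Q0 :: "real ^ 'n ^ ('u \<times> 'n)"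
    and P0 :: "real ^ ('u \<times> 'n) ^ ('u \<times> 'n)"
  assumes Q0: "stochastic Q0"
    and R0: "stochastic R0"
    and P0: "P0 = controlled R0 Q0"
    and irr: "irreducible_matrix P0"
begin

definition Lam :: "real ^ ('u \<times> 'n) \<Rightarrow> real ^ ('u \<times> 'n)" where
  "Lam h = (\<chi> x. log_norm Q0 P0 h x)"

definition tilted_policy :: "real ^ ('u \<times> 'n) \<Rightarrow> real ^ 'u ^ ('u \<times> 'n)" where
  "tilted_policy h = (\<chi> x u. R0 $ x $ u * exp (cond_mean Q0 h x u - Lam h $ x))"

lemma R0_prob: "0 \<le> R0 $ x $ u" "(\<Sum>u\<in>UNIV. R0 $ x $ u) = 1"
  using R0 by (rule stochastic_nonneg, rule stochastic_sum)

lemma exp_Lam: "exp (Lam h $ x) = (\<Sum>u\<in>UNIV. R0 $ x $ u * exp (cond_mean Q0 h x u))"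
proof -
  obtain v where "0 < R0 $ x $ v"
    using R0_prob[of x] by (metis less_le sum.neutral zero_neq_one)
  then have "0 < (\<Sum>u\<in>UNIV. R0 $ x $ u * exp (cond_mean Q0 h x u))"
    by (intro sum_pos2[of _ v]) (auto simp: R0_prob)
  then show ?thesis
    using sum_controlled_fst[OF Q0, of R0 x "\<lambda>u. exp (cond_mean Q0 h x u)"]
    by (simp add: Lam_def log_norm_def flip: P0)
qed

lemma stochastic_tilted_policy: "stochastic (tilted_policy h)"
  unfolding stochastic_def prob_vec_def
proof (intro allI conjI)
  fix x
  have "(\<Sum>u\<in>UNIV. tilted_policy h $ x $ u)
      = (\<Sum>u\<in>UNIV. R0 $ x $ u * exp (cond_mean Q0 h x u)) / exp (Lam h $ x)"
    by (simp add: tilted_policy_def exp_diff sum_divide_distrib)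
  also have "\<dots> = 1"
    by (metis exp_Lam div_self exp_not_eq_zero)
  finally show "(\<Sum>u\<in>UNIV. tilted_policy h $ x $ u) = 1" .
qed (simp add: tilted_policy_def R0_prob)

text \<open>The tilt depends on the next state only through its controlled component, so the tilted
  matrix stays in the admissible class.\<close>

lemma tilted_eq_controlled: "tilted Q0 P0 h = controlled (tilted_policy h) Q0"
  using arg_cong[OF P0, of "\<lambda>P. P $ x $ y" for x y]
  by (simp add: tilted_def controlled_def tilted_policy_def Lam_def vec_eq_iff)

lemma stochastic_tilted: "stochastic (tilted Q0 P0 h)"
  unfolding tilted_eq_controlled by (intro stochastic_controlled stochastic_tilted_policy Q0)

lemma stochastic_P0: "stochastic P0"
  unfolding P0 by (intro stochastic_controlled R0 Q0)

lemma P0_nonneg: "0 \<le> P0 $ x $ y"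
  using stochastic_P0 by (rule stochastic_nonneg)

lemma irreducible_tilted: "irreducible_matrix (tilted Q0 P0 h)"
  by (rule irreducible_matrix_mono_support[OF irr]) (auto simp: tilted_def P0_nonneg)

text \<open>Gibbs' variational identity: maximising the left side over such \<open>R\<close> yields
  \<open>Lam h $ x\<close>, attained at \<open>tilted_policy h\<close>.\<close>

lemma policy_value:
  assumes "stochastic R" and "\<And>u. 0 < R $ x $ u \<Longrightarrow> 0 < R0 $ x $ u"
  shows "(controlled R Q0 *v h) $ x - KL_div (R $ x) (R0 $ x)
      = Lam h $ x - KL_div (R $ x) (tilted_policy h $ x)"
  using KL_div_tilt[OF stochasticD[OF assms(1)] assms(2), where f = "cond_mean Q0 h x" and L = "Lam h $ x"]
  by (simp add: controlled_mult tilted_policy_def)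

text \<open>Convexity of \<open>Lam\<close>, with \<open>tilted Q0 P0 h\<close> as gradient at
  \<open>h\<close>. The policy optimal for \<open>h\<close> is evaluated against both
  \<open>h\<close> and \<open>g\<close>; for \<open>g\<close> it falls short of \<open>Lam g\<close>
  by a relative entropy.\<close>

lemma Lam_diff_le: "Lam h - Lam g \<le> tilted Q0 P0 h *v (h - g)"
  unfolding less_eq_vec_def
proof
  fix x
  let ?R = "tilted_policy h"
  have ac: "0 < ?R $ x $ u \<Longrightarrow> 0 < R0 $ x $ u" "0 < ?R $ x $ u \<Longrightarrow> 0 < tilted_policy g $ x $ u" for u
    by (auto simp: tilted_policy_def zero_less_mult_iff)
  have "0 \<le> KL_div (?R $ x) (tilted_policy g $ x)"
    by (intro KL_div_nonneg stochasticD stochastic_tilted_policy ac(2))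
  then show "(Lam h - Lam g) $ x \<le> (tilted Q0 P0 h *v (h - g)) $ x"
    using policy_value[OF stochastic_tilted_policy[of h] ac(1), of h]
      policy_value[OF stochastic_tilted_policy[of h] ac(1), of g]
    by (simp add: tilted_eq_controlled matrix_vector_mult_diff_distrib KL_div_self)
qed

lemma Lam_0: "Lam 0 = 0"
proof -
  have "exp (Lam 0 $ x) = 1" for x
    by (simp add: exp_Lam cond_mean_def R0_prob)
  then show ?thesis
    by (simp add: vec_eq_iff)
qed

lemma tilted_0: "tilted Q0 P0 0 = P0"
  using Lam_0 by (simp add: tilted_def cond_mean_def vec_eq_iff Lam_def)

lemma Lam_has_derivative: "(Lam has_derivative (\<lambda>v. tilted Q0 P0 h *v v)) (at h)"
proof -
  have "((\<lambda>h. Lam h $ x) has_derivative (\<lambda>v. (tilted Q0 P0 h *v v) $ x)) (at h)" for x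
  proof -
    let ?S = "\<lambda>h. \<Sum>u\<in>UNIV. R0 $ x $ u * exp (cond_mean Q0 h x u)"
    have S: "?S h = exp (Lam h $ x)" for h
      by (simp add: exp_Lam)
    have cm: "((\<lambda>h. cond_mean Q0 h x u) has_derivative (\<lambda>v. cond_mean Q0 v x u)) (at h)" for u
      unfolding cond_mean_def
      by (intro bounded_linear_imp_has_derivative bounded_linear_sum
          bounded_linear_const_mult bounded_linear_vec_nth)
    have "(?S has_derivative
        (\<lambda>v. \<Sum>u\<in>UNIV. R0 $ x $ u * (exp (cond_mean Q0 h x u) * cond_mean Q0 v x u))) (at h)"
      by (auto intro!: derivative_eq_intros cm simp: algebra_simps)
    then have "((\<lambda>h. ln (?S h)) has_derivative
        (\<lambda>v. (\<Sum>u\<in>UNIV. R0 $ x $ u * (exp (cond_mean Q0 h x u) * cond_mean Q0 v x u)) * inverse (?S h))) (at h)"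
      by (rule has_derivative_ln[rotated]) (simp add: S)
    moreover have "(\<Sum>u\<in>UNIV. R0 $ x $ u * (exp (cond_mean Q0 h x u) * cond_mean Q0 v x u)) * inverse (?S h)
        = (tilted Q0 P0 h *v v) $ x" for v
      unfolding S tilted_eq_controlled controlled_mult
      by (simp add: tilted_policy_def exp_diff sum_distrib_left divide_inverse mult_ac)
    ultimately show ?thesis
      by (simp add: S)
  qed
  then show ?thesis
    by (subst has_derivative_componentwise_within) (auto simp: Basis_vec_def inner_axis)
qed

text \<open>By \<open>policy_value\<close> the bracket is the right-hand value minus a relative
  entropy, or minus infinity without absolute continuity. The tilted policy attains the maximum, and
  all maximisers share its value.\<close>

lemma relative_value_iff:
  "relative_value R0 Q0 U x0 \<zeta> g \<eta> \<longleftrightarrow> g $ x0 = 0 \<and> \<zeta> *\<^sub>R U + Lam g = g + \<eta> *\<^sub>R 1"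
proof -
  have "(\<exists>R. is_arg_max f stochastic R \<and> f R = ereal (g $ x + \<eta>)) \<longleftrightarrow> \<zeta> * U $ x + Lam g $ x = g $ x + \<eta>"
    if f: "f = (\<lambda>R. reward R0 U \<zeta> x R
                    + ereal (\<Sum>x'\<in>UNIV. R $ x $ fst x' * Q0 $ x $ snd x' * g $ x'))" for f x
  proof -
    let ?v = "ereal (\<zeta> * U $ x + Lam g $ x)"
    have fR: "f R = ereal (\<zeta> * U $ x + Lam g $ x - KL_div (R $ x) (tilted_policy g $ x))"
      if "stochastic R" "\<And>u. 0 < R $ x $ u \<Longrightarrow> 0 < R0 $ x $ u" for R
    proof -
      have "\<not> (\<exists>u. 0 < R $ x $ u \<and> R0 $ x $ u = 0)"
        using that(2) by force
      moreover have "(\<Sum>x'\<in>UNIV. R $ x $ fst x' * Q0 $ x $ snd x' * g $ x') = (controlled R Q0 *v g) $ x"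
        by (simp add: controlled_def matrix_vector_mult_def)
      ultimately show ?thesis
        using policy_value[OF that, of g] by (simp add: f reward_def KL_div_def)
    qed
    have le: "f R \<le> ?v" if "stochastic R" for R
    proof (cases "\<exists>u. 0 < R $ x $ u \<and> R0 $ x $ u = 0")
      case False
      then have ac: "0 < R $ x $ u \<Longrightarrow> 0 < R0 $ x $ u" for u
        using R0_prob by (metis less_le)
      have "0 \<le> KL_div (R $ x) (tilted_policy g $ x)"
        using ac by (intro KL_div_nonneg stochasticD that stochastic_tilted_policy) (simp add: tilted_policy_def)
      then show ?thesis
        by (simp add: fR[OF that ac])
    qed (simp add: f reward_def)
    have eq: "f (tilted_policy g) = ?v"
      by (subst fR[OF stochastic_tilted_policy]) (auto simp: KL_div_self tilted_policy_def zero_less_mult_iff)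
    have "is_arg_max f stochastic (tilted_policy g)"
      using le eq stochastic_tilted_policy by (auto simp: is_arg_max_def not_less)
    moreover have "f R = ?v" if "is_arg_max f stochastic R" for R
      using that le[of R] eq stochastic_tilted_policy by (metis is_arg_max_def order_le_less)
    ultimately show ?thesis
      using eq by (metis ereal.inject)
  qed
  then show ?thesis
    by (auto simp: relative_value_def Let_def vec_eq_iff)
qed

section \<open>Uniqueness for the dynamic programming equation\<close>

text \<open>Convexity at \<open>h\<close> compares \<open>h - g\<close>, shifted by
  \<open>a - b\<close>, with its image under the tilted matrix; averaging over the invariant pmf of
  that matrix leaves only \<open>a - b\<close>.\<close>

lemma eigenvalue_le:
  assumes "h - Lam h + a *\<^sub>R 1 = W" "g - Lam g + b *\<^sub>R 1 = W"
  shows "a \<le> b"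
proof -
  let ?T = "tilted Q0 P0 h"
  obtain q where q: "invariant ?T q"
    using invariant_exists[OF stochastic_tilted] by blast
  then have qv: "prob_vec q"
    by (simp add: invariant_def)
  have "Lam h - Lam g = h - g + (a - b) *\<^sub>R 1"
    using assms by (simp add: algebra_simps)
  then have "h - g + (a - b) *\<^sub>R 1 \<le> ?T *v (h - g)"
    using Lam_diff_le[of h g] by simp
  from prob_vec_inner_mono[OF qv this] show ?thesis
    by (simp add: inner_add_right inner_invariant[OF q] prob_vec_inner_one[OF qv])
qed

text \<open>Symmetry gives \<open>a = b\<close>. Then \<open>h - g\<close> is subharmonic for the
  tilted matrix, hence constant, and it vanishes at \<open>x0\<close>.\<close>

lemma eigenvector_unique:
  assumes h: "h - Lam h + a *\<^sub>R 1 = W" and g: "g - Lam g + b *\<^sub>R 1 = W"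
    and "h $ x0 = g $ x0"
  shows "a = b" "h = g"
proof -
  show ab: "a = b"
    using eigenvalue_le[OF h g] eigenvalue_le[OF g h] by simp
  have "h - Lam h = g - Lam g"
    using h g ab by (metis add_right_cancel)
  then have "Lam h - Lam g = h - g"
    by (simp add: algebra_simps)
  then have "h - g \<le> tilted Q0 P0 h *v (h - g)"
    using Lam_diff_le[of h g] by simp
  then have "(h - g) $ x = (h - g) $ x0" for x
    by (rule subharmonic_const[OF stochastic_tilted irreducible_tilted])
  then show "h = g"
    using assms(3) by (simp add: vec_eq_iff)
qed

section \<open>Bijectivity of the dynamic programming map\<close>

text \<open>The unknowns \<open>(h, \<eta>)\<close> with \<open>h(x\<^sup>\<circ>) = 0\<close> are packed into one vector \<open>z\<close>, with \<open>\<eta>\<close> in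
  the free slot \<open>x\<^sup>\<circ>\<close>. The dynamic programming equation becomes \<open>bellman x\<^sup>\<circ> z = \<zeta> U\<close>.\<close>

definition bellman :: "'u \<times> 'n \<Rightarrow> real ^ ('u \<times> 'n) \<Rightarrow> real ^ ('u \<times> 'n)" where
  "bellman x0 z = zero_at x0 z - Lam (zero_at x0 z) + (z $ x0) *\<^sub>R 1"

lemma inj_bellman: "inj (bellman x0)"
proof (rule injI)
  fix z w assume eq: "bellman x0 z = bellman x0 w"
  have "zero_at x0 z $ x0 = zero_at x0 w $ x0"
    by (simp add: zero_at_nth)
  note uniq = eigenvector_unique[OF eq[unfolded bellman_def] refl this]
  show "z = w"
    by (rule zero_at_eqD[OF uniq(2,1)])
qed

lemma bellman_has_derivative:
  "(bellman x0 has_derivative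
     (\<lambda>v. zero_at x0 v - tilted Q0 P0 (zero_at x0 z) *v zero_at x0 v + (v $ x0) *\<^sub>R 1)) (at z)"
proof -
  have Lam: "((\<lambda>z. Lam (zero_at x0 z)) has_derivative
      (\<lambda>v. tilted Q0 P0 (zero_at x0 z) *v zero_at x0 v)) (at z)"
    by (rule has_derivative_compose[OF has_derivative_zero_at Lam_has_derivative])
  have slot: "((\<lambda>z. (z $ x0) *\<^sub>R 1) has_derivative (\<lambda>v. (v $ x0) *\<^sub>R (1 :: real ^ ('u \<times> 'n)))) (at z)"
    by (rule has_derivative_scaleR_left[OF bounded_linear_imp_has_derivative[OF bounded_linear_vec_nth]])
  show ?thesis
    unfolding bellman_def
    by (rule has_derivative_add[OF has_derivative_diff[OF has_derivative_zero_at Lam] slot])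
qed

lemma continuous_bellman: "continuous_on S (bellman x0)"
proof (rule continuous_at_imp_continuous_on, rule ballI)
  fix z
  show "isCont (bellman x0) z"
    using bellman_has_derivative by (rule has_derivative_continuous)
qed

text \<open>Convexity against 0 bounds \<open>Lam h\<close> by the tilted matrix applied to
  \<open>h\<close>; averaging over its invariant pmf cancels \<open>h\<close> and leaves the
  eigenvalue.\<close>

lemma bellman_eigenvalue_le: "z $ x0 \<le> norm (bellman x0 z)"
proof -
  let ?h = "zero_at x0 z"
  obtain q where q: "invariant (tilted Q0 P0 ?h) q"
    using invariant_exists[OF stochastic_tilted] by blast
  then have qv: "prob_vec q"
    by (simp add: invariant_def)
  have "Lam ?h \<le> tilted Q0 P0 ?h *v ?h"
    using Lam_diff_le[of ?h 0] by (simp add: Lam_0)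
  from prob_vec_inner_mono[OF qv this] have "z $ x0 \<le> q \<bullet> bellman x0 z"
    by (simp add: bellman_def inner_add_right inner_diff_right inner_invariant[OF q] prob_vec_inner_one[OF qv])
  also have "\<dots> \<le> norm (bellman x0 z)"
    using prob_vec_inner_le_norm[OF qv, of "bellman x0 z"] by simp
  finally show ?thesis .
qed

text \<open>Since \<open>Lam h \<ge> P\<^sub>0 h\<close>, the linearisation at \<open>0\<close> exceeds \<open>bellman\<close> by a nonnegative vector
  whose mean under the invariant pmf of \<open>P\<^sub>0\<close> is controlled; linear algebra then bounds \<open>z\<close>.\<close>

lemma bellman_coercive:
  obtains C where "\<And>z. norm z \<le> C * norm (bellman x0 z)"
proof -
  define L where "L = (\<lambda>z. zero_at x0 z - P0 *v zero_at x0 z + (z $ x0) *\<^sub>R (1 :: real ^ ('u \<times> 'n)))"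
  have lin: "linear L"
    unfolding L_def
    by (intro linear_compose_add linear_compose_sub linear_zero_at
        linear_compose[OF linear_zero_at matrix_vector_mul_linear, unfolded o_def])
       (rule linearI, simp_all add: scaleR_add_left)
  have "inj L"
    unfolding linear_injective_0[OF lin]
  proof (intro allI impI)
    fix z assume "L z = 0"
    then obtain c where z: "z $ x0 = 0" and c: "zero_at x0 z = c *\<^sub>R 1"
      using Poisson_unique[OF stochastic_P0 irr, of "zero_at x0 z" "z $ x0" x0] unfolding L_def by blast
    have "c = zero_at x0 z $ x0"
      by (simp add: c)
    then have "c = 0"
      by (simp add: zero_at_nth)
    then have "zero_at x0 z = zero_at x0 0"
      by (simp add: c linear_0[OF linear_zero_at])
    then show "z = 0"
      by (rule zero_at_eqD) (simp add: z)
  qed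
  then obtain B where B: "0 < B" "\<And>z. B * norm z \<le> norm (L z)"
    using linear_inj_bounded_below_pos[OF lin] by blast
  obtain p where p: "invariant P0 p"
    using invariant_exists[OF stochastic_P0] by blast
  then have pv: "prob_vec p"
    by (simp add: invariant_def)
  have pos: "0 < p $ x" for x
    by (rule invariant_pos[OF stochastic_P0 irr p])
  \<comment> \<open>A nonnegative vector with \<open>p\<close>-mean \<open>m\<close> has entries at
    most \<open>m / p $ x\<close>, so \<open>K * m\<close> bounds its sum of entries and hence its
    norm.\<close>
  define K where "K = (\<Sum>x\<in>UNIV. 1 / p $ x)"
  have up: "norm (L z) \<le> (1 + 2 * K) * norm (bellman x0 z)" for z
  proof -
    let ?W = "bellman x0 z"
    have "Lam 0 - Lam (zero_at x0 z) \<le> P0 *v 0 - P0 *v zero_at x0 z"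
      using Lam_diff_le[of 0 "zero_at x0 z"] unfolding tilted_0 matrix_vector_mult_diff_distrib .
    then have "P0 *v zero_at x0 z \<le> Lam (zero_at x0 z)"
      by (simp add: Lam_0)
    then have "(P0 *v zero_at x0 z) $ x \<le> Lam (zero_at x0 z) $ x" for x
      unfolding less_eq_vec_def by blast
    then have nn: "0 \<le> (L z - ?W) $ x" for x
      by (simp add: L_def bellman_def)
    have "p \<bullet> (L z - ?W) = z $ x0 - p \<bullet> ?W"
      by (simp add: L_def inner_diff_right inner_add_right inner_invariant[OF p] prob_vec_inner_one[OF pv])
    also have "\<dots> \<le> 2 * norm ?W"
      using bellman_eigenvalue_le[of z x0] prob_vec_inner_le_norm[OF pv, of ?W] by linarith
    finally have mean: "p \<bullet> (L z - ?W) \<le> 2 * norm ?W" .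
    have "\<bar>(L z - ?W) $ x\<bar> \<le> 1 / p $ x * (2 * norm ?W)" for x
    proof -
      have "p $ x * (L z - ?W) $ x \<le> p \<bullet> (L z - ?W)"
        unfolding inner_vec_def inner_real_def
        by (rule member_le_sum) (simp_all only: UNIV_I finite mult_nonneg_nonneg nn less_imp_le[OF pos])
      also note mean
      finally have "(L z - ?W) $ x \<le> 2 * norm ?W / p $ x"
        using pos[of x] by (simp only: pos_le_divide_eq mult.commute)
      then show ?thesis
        by (simp only: abs_of_nonneg[OF nn] times_divide_eq_left mult_1_left)
    qed
    then have "(\<Sum>x\<in>UNIV. \<bar>(L z - ?W) $ x\<bar>) \<le> K * (2 * norm ?W)"
      unfolding K_def sum_distrib_right by (intro sum_mono)
    with norm_le_l1_cart[of "L z - ?W"] have "norm (L z - ?W) \<le> K * (2 * norm ?W)"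
      by linarith
    with norm_triangle_sub[of "L z" ?W] show ?thesis
      by (simp add: algebra_simps)
  qed
  have "norm z \<le> (1 + 2 * K) / B * norm (bellman x0 z)" for z
  proof -
    have "norm z * B \<le> (1 + 2 * K) * norm (bellman x0 z)"
      using order_trans[OF B(2) up, of z] by (simp only: mult.commute)
    then show ?thesis
      by (simp only: pos_le_divide_eq[OF B(1)] times_divide_eq_left)
  qed
  then show thesis
    by (rule that)
qed

lemma closed_range_bellman: "closed (range (bellman x0))"
proof -
  obtain C where C: "\<And>z. norm z \<le> C * norm (bellman x0 z)"
    using bellman_coercive by blast
  show ?thesis
    unfolding closed_sequential_limits
  proof (intro allI impI, elim conjE)
    fix W l assume W: "\<forall>n. W n \<in> range (bellman x0)" and lim: "W \<longlonglongrightarrow> l"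
    obtain M where M: "\<And>n. norm (W n) \<le> M"
      using convergent_imp_Bseq[OF convergentI[OF lim]] by (auto simp: Bseq_def)
    \<comment> \<open>Coercivity confines preimages of the bounded sequence to a ball, whose image
      is compact. The absolute value is taken because the sign of \<open>C\<close> is
      unknown.\<close>
    let ?K = "cball 0 (\<bar>C\<bar> * M)"
    have "W n \<in> bellman x0 ` ?K" for n
    proof -
      obtain z where z: "W n = bellman x0 z"
        using W by blast
      have "norm z \<le> \<bar>C\<bar> * norm (W n)"
        using order_trans[OF C[of z] mult_right_mono[OF abs_ge_self norm_ge_zero]] unfolding z .
      also have "\<dots> \<le> \<bar>C\<bar> * M"
        using M by (intro mult_left_mono) auto
      finally show ?thesis
        using z by auto
    qed
    moreover have "closed (bellman x0 ` ?K)"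
      by (intro compact_imp_closed compact_continuous_image continuous_bellman compact_cball)
    ultimately have "l \<in> bellman x0 ` ?K"
      by (rule closed_sequentially[rotated, OF _ lim])
    then show "l \<in> range (bellman x0)"
      by blast
  qed
qed

text \<open>The range is open, closed and nonempty in a connected space.\<close>

lemma surj_bellman: "surj (bellman x0)"
proof -
  have "open (range (bellman x0))"
    by (rule invariance_of_domain[OF continuous_bellman open_UNIV inj_bellman])
  then show ?thesis
    using closed_range_bellman[of x0] clopen[of "range (bellman x0)"] by simp
qed

text \<open>The inverse function theorem asks for a right inverse of the derivative. Poisson's
  equation supplies it: \<open>H_op W x0\<close> solves up to the mean of \<open>W\<close>, and that
  mean goes into the slot \<open>x0\<close>, where \<open>H_op\<close> vanishes.\<close>

lemma inv_bellman_has_derivative: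
  "(inv (bellman x0) has_derivative
     (\<lambda>W. \<chi> x. if x = x0 then invariant_pmf (tilted Q0 P0 (zero_at x0 z)) \<bullet> W
              else H_op W x0 (tilted Q0 P0 (zero_at x0 z)) $ x)) (at (bellman x0 z))"
    (is "(_ has_derivative ?g') _")
proof (rule has_derivative_inverse_strong[OF open_UNIV UNIV_I continuous_bellman _ bellman_has_derivative])
  show "inv (bellman x0) (bellman x0 z) = z" for z
    by (simp add: inj_bellman)
  let ?T = "tilted Q0 P0 (zero_at x0 z)"
  show "(\<lambda>v. zero_at x0 v - ?T *v zero_at x0 v + (v $ x0) *\<^sub>R 1) \<circ> ?g' = id"
  proof
    fix W
    have "zero_at x0 (?g' W) = H_op W x0 ?T"
      by (simp add: vec_eq_iff zero_at_nth H_op_base)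
    then show "((\<lambda>v. zero_at x0 v - ?T *v zero_at x0 v + (v $ x0) *\<^sub>R 1) \<circ> ?g') W = id W"
      using H_op_Poisson[OF stochastic_tilted irreducible_tilted, of W x0 "zero_at x0 z"] by simp
  qed
qed

section \<open>Solutions of the differential equation\<close>

text \<open>The inverse of \<open>bellman x0\<close> is defined on the whole space, so following it
  along the line through \<open>U\<close> gives a solution for all times at once.\<close>

lemma ode_solution_exists: "ode_solution Q0 P0 U x0 (\<lambda>\<zeta>. zero_at x0 (inv (bellman x0) (\<zeta> *\<^sub>R U)))"
  unfolding ode_solution_def
proof (intro conjI allI)
  let ?G = "inv (bellman x0)"
  have "bellman x0 0 = 0"
    by (simp add: bellman_def linear_0[OF linear_zero_at] Lam_0)
  then have "?G 0 = 0"
    by (metis inj_bellman inv_f_f)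
  then show "zero_at x0 (?G (0 *\<^sub>R U)) = 0"
    by (simp add: linear_0[OF linear_zero_at])
  fix \<zeta>
  define z where "z = ?G (\<zeta> *\<^sub>R U)"
  let ?T = "tilted Q0 P0 (zero_at x0 z)"
  let ?g' = "\<lambda>W. \<chi> x. if x = x0 then invariant_pmf ?T \<bullet> W else H_op W x0 ?T $ x"
  have z: "bellman x0 z = \<zeta> *\<^sub>R U"
    unfolding z_def by (rule surj_f_inv_f[OF surj_bellman])
  have der: "(?G has_derivative ?g') (at (\<zeta> *\<^sub>R U))"
    using inv_bellman_has_derivative[of x0 z] by (simp only: z)
  have scale: "((\<lambda>\<zeta>. \<zeta> *\<^sub>R U) has_derivative (\<lambda>t. t *\<^sub>R U)) (at \<zeta>)"
    by (auto intro!: derivative_eq_intros)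
  have "((\<lambda>\<zeta>. zero_at x0 (?G (\<zeta> *\<^sub>R U))) has_derivative (\<lambda>t. zero_at x0 (?g' (t *\<^sub>R U)))) (at \<zeta>)"
    by (rule has_derivative_compose[OF has_derivative_compose[OF scale der] has_derivative_zero_at])
  moreover have "zero_at x0 (?g' (t *\<^sub>R U)) = t *\<^sub>R H_op U x0 ?T" for t
  proof -
    \<comment> \<open>Linearity of \<open>?g'\<close> comes for free from its being a
      derivative.\<close>
    have "zero_at x0 (?g' (t *\<^sub>R U)) = t *\<^sub>R zero_at x0 (?g' U)"
      by (simp only: linear_scale[OF has_derivative_linear[OF der]] linear_scale[OF linear_zero_at])
    also have "zero_at x0 (?g' U) = H_op U x0 ?T"
      by (simp add: vec_eq_iff zero_at_nth H_op_base)
    finally show ?thesis .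
  qed
  ultimately show "((\<lambda>\<zeta>. zero_at x0 (?G (\<zeta> *\<^sub>R U))) has_vector_derivative
      H_op U x0 (tilted Q0 P0 (zero_at x0 (?G (\<zeta> *\<^sub>R U))))) (at \<zeta>)"
    by (simp add: has_vector_derivative_def z_def)
qed

lemma ode_solution_imp_eigenvector:
  assumes ode: "ode_solution Q0 P0 U x0 h"
  shows "h \<zeta> $ x0 = 0" "\<exists>\<eta>. h \<zeta> - Lam (h \<zeta>) + \<eta> *\<^sub>R 1 = \<zeta> *\<^sub>R U"
proof -
  have h0: "h 0 = 0"
    using ode by (simp add: ode_solution_def)
  have der: "(h has_vector_derivative H_op U x0 (tilted Q0 P0 (h \<zeta>))) (at \<zeta>)" for \<zeta>
    using ode unfolding ode_solution_def by blast
  have "((\<lambda>\<zeta>. h \<zeta> $ x0) has_vector_derivative 0) (at \<zeta>)" for \<zeta>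
    using bounded_linear.has_vector_derivative[OF bounded_linear_vec_nth der, of x0 \<zeta>]
    by (simp add: H_op_base)
  then have "h \<zeta> $ x0 = h 0 $ x0"
    by (intro DERIV_isconst_all) (simp add: has_real_derivative_iff_has_vector_derivative)
  then show "h \<zeta> $ x0 = 0"
    by (simp add: h0)
  \<comment> \<open>This is to become the eigenvalue times the constant function 1. It vanishes at
    time 0, and the differences of its coordinates have zero derivative.\<close>
  define \<Phi> where "\<Phi> = (\<lambda>\<zeta>. Lam (h \<zeta>) - h \<zeta> + \<zeta> *\<^sub>R U)"
  have "(\<Phi> has_vector_derivative (invariant_pmf (tilted Q0 P0 (h \<zeta>)) \<bullet> U) *\<^sub>R 1) (at \<zeta>)" for \<zeta>
  proof -
    let ?T = "tilted Q0 P0 (h \<zeta>)"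
    have "((\<lambda>\<zeta>. Lam (h \<zeta>)) has_vector_derivative ?T *v H_op U x0 ?T) (at \<zeta>)"
      using vector_derivative_diff_chain_within[OF der has_derivative_at_withinI[OF Lam_has_derivative]]
      by (simp add: o_def)
    then have "(\<Phi> has_vector_derivative ?T *v H_op U x0 ?T - H_op U x0 ?T + U) (at \<zeta>)"
      unfolding \<Phi>_def by (auto intro!: derivative_eq_intros der)
    moreover have "?T *v H_op U x0 ?T - H_op U x0 ?T + U = (invariant_pmf ?T \<bullet> U) *\<^sub>R 1"
      using H_op_Poisson[OF stochastic_tilted irreducible_tilted, of U x0 "h \<zeta>"]
      by (simp add: algebra_simps)
    ultimately show ?thesis
      by simp
  qed
  then have "((\<lambda>\<zeta>. \<Phi> \<zeta> $ x - \<Phi> \<zeta> $ x0) has_vector_derivative 0) (at \<zeta>)" for \<zeta> x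
    using bounded_linear.has_vector_derivative[OF bounded_linear_sub[OF
          bounded_linear_vec_nth[of x] bounded_linear_vec_nth[of x0]]] by fastforce
  then have "\<Phi> \<zeta> $ x - \<Phi> \<zeta> $ x0 = \<Phi> 0 $ x - \<Phi> 0 $ x0" for x
    by (intro DERIV_isconst_all[of "\<lambda>\<zeta>. \<Phi> \<zeta> $ x - \<Phi> \<zeta> $ x0"])
       (simp add: has_real_derivative_iff_has_vector_derivative)
  then have "\<Phi> \<zeta> = (\<Phi> \<zeta> $ x0) *\<^sub>R 1"
    by (simp add: vec_eq_iff \<Phi>_def h0 Lam_0)
  then have "h \<zeta> - Lam (h \<zeta>) + (\<Phi> \<zeta> $ x0) *\<^sub>R 1 = \<zeta> *\<^sub>R U"
    unfolding \<Phi>_def by (simp add: vec_eq_iff algebra_simps)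
  then show "\<exists>\<eta>. h \<zeta> - Lam (h \<zeta>) + \<eta> *\<^sub>R 1 = \<zeta> *\<^sub>R U"
    by blast
qed

section \<open>Optimality of the tilted matrix\<close>

text \<open>Changing the reference from \<open>P0\<close> to the tilted matrix adds the mean of
  \<open>P *v h - Lam h\<close>. Invariance turns this into the mean of \<open>h - Lam h\<close>,
  which by \<open>h\<close> is the mean reward minus \<eta>.\<close>

lemma objective_eq:
  assumes h: "h - Lam h + \<eta> *\<^sub>R 1 = \<zeta> *\<^sub>R U"
    and R: "stochastic R" "P = controlled R Q0" and p: "invariant P p"
    and ac: "\<And>x y. 0 < p $ x \<Longrightarrow> 0 < P $ x $ y \<Longrightarrow> 0 < P0 $ x $ y"
  shows "ereal (\<zeta> * (\<Sum>x\<in>UNIV. p $ x * U $ x)) - KL_rate p P P0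
    = ereal (\<eta> - (\<Sum>x\<in>UNIV. p $ x * KL_div (P $ x) (tilted Q0 P0 h $ x)))"
proof -
  have pv: "prob_vec p"
    using p by (simp add: invariant_def)
  note pnn = prob_vec_nonneg[OF this]
  have P: "stochastic P"
    unfolding R(2) by (intro stochastic_controlled R(1) Q0)
  have "\<not> (\<exists>x y. 0 < p $ x * P $ x $ y \<and> P0 $ x $ y = 0)"
  proof clarify
    fix x y assume "0 < p $ x * P $ x $ y" "P0 $ x $ y = 0"
    then show False
      using ac[of x y] pnn[of x] stochastic_nonneg[OF P, of x y] by (auto simp: zero_less_mult_iff)
  qed
  then have "KL_rate p P P0 = ereal (\<Sum>x\<in>UNIV. p $ x * KL_div (P $ x) (P0 $ x))"
    by (simp add: KL_rate_def KL_div_def sum_distrib_left mult.assoc)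
  moreover have "p $ x * KL_div (P $ x) (P0 $ x)
      = p $ x * KL_div (P $ x) (tilted Q0 P0 h $ x) + (p $ x * (P *v h) $ x - p $ x * Lam h $ x)" for x
  \<comment> \<open>Absolute continuity is known only for rows charged by \<open>p\<close>; the
    others have weight 0.\<close>
  proof (cases "p $ x = 0")
    case False
    have "KL_div (P $ x) (P0 $ x)
        = KL_div (P $ x) (tilted Q0 P0 h $ x) + (\<Sum>y\<in>UNIV. P $ x $ y * cond_mean Q0 h x (fst y)) - Lam h $ x"
    proof -
      have "0 < p $ x"
        using False pnn[of x] by simp
      from KL_div_tilt[OF stochasticD[OF P] ac[OF this], where f = "\<lambda>y. cond_mean Q0 h x (fst y)" and L = "Lam h $ x"]
      show ?thesis
        by (simp add: tilted_def Lam_def)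
    qed
    also have "(\<Sum>y\<in>UNIV. P $ x $ y * cond_mean Q0 h x (fst y)) = (P *v h) $ x"
      unfolding R(2) controlled_mult by (rule sum_controlled_fst[OF Q0])
    finally have eq: "KL_div (P $ x) (P0 $ x)
        = KL_div (P $ x) (tilted Q0 P0 h $ x) + (P *v h) $ x - Lam h $ x" .
    show ?thesis
      unfolding eq by (simp add: algebra_simps)
  qed simp
  then have "(\<Sum>x\<in>UNIV. p $ x * KL_div (P $ x) (P0 $ x))
      = (\<Sum>x\<in>UNIV. p $ x * KL_div (P $ x) (tilted Q0 P0 h $ x)) + (p \<bullet> (P *v h) - p \<bullet> Lam h)"
    by (simp add: inner_vec_def sum.distrib sum_subtractf)
  moreover have "p \<bullet> (h - Lam h + \<eta> *\<^sub>R 1) = p \<bullet> (\<zeta> *\<^sub>R U)"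
    using h by simp
  then have "p \<bullet> (P *v h) - p \<bullet> Lam h = \<zeta> * (\<Sum>x\<in>UNIV. p $ x * U $ x) - \<eta>"
    by (simp add: inner_diff_right inner_add_right prob_vec_inner_one[OF pv] inner_invariant[OF p])
       (simp add: inner_vec_def)
  ultimately show ?thesis
    by simp
qed

text \<open>The objective is at most \<eta>, with equality only if the mean relative entropy to the
  tilted matrix vanishes.\<close>

lemma optimal_matrix_iff:
  assumes h: "h - Lam h + \<eta> *\<^sub>R 1 = \<zeta> *\<^sub>R U"
  shows "optimal_matrix Q0 P0 U \<zeta> P \<longleftrightarrow> P = tilted Q0 P0 h"
proof -
  let ?T = "tilted Q0 P0 h" and ?q = "invariant_pmf (tilted Q0 P0 h)"
  define obj where "obj = (\<lambda>p P. ereal (\<zeta> * (\<Sum>x\<in>UNIV. p $ x * U $ x)) - KL_rate p P P0)"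
  define feas where "feas = (\<lambda>p P. (\<exists>R. stochastic R \<and> P = controlled R Q0) \<and> invariant P p)"
  have opt: "optimal_matrix Q0 P0 U \<zeta> P \<longleftrightarrow>
      (\<exists>p. feas p P \<and> (\<forall>p' P'. feas p' P' \<longrightarrow> obj p' P' \<le> obj p P))" for P
  proof -
    have "optimal_matrix Q0 P0 U \<zeta> P \<longleftrightarrow>
        (\<exists>p. is_arg_max (\<lambda>(p, P). obj p P) (\<lambda>(p, P). feas p P) (p, P))"
      unfolding optimal_matrix_def obj_def feas_def ..
    then show ?thesis
      by (auto simp: is_arg_max_def not_less)
  qed
  have T: "stochastic ?T" "irreducible_matrix ?T"
    by (rule stochastic_tilted, rule irreducible_tilted)
  have q: "invariant ?T ?q"
    by (rule invariant_invariant_pmf[OF T])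
  have feasT: "feas ?q ?T"
    unfolding feas_def using q tilted_eq_controlled stochastic_tilted_policy by blast
  have TP0: "0 < ?T $ x $ y \<longleftrightarrow> 0 < P0 $ x $ y" for x y
    by (simp add: tilted_def zero_less_mult_iff)
  have objT: "obj ?q ?T = ereal \<eta>"
    unfolding obj_def
    by (subst objective_eq[OF h stochastic_tilted_policy tilted_eq_controlled q]) (simp_all add: TP0 KL_div_self)
  have feas_cases: "obj p P = - \<infinity> \<or>
      (\<exists>D. obj p P = ereal (\<eta> - D) \<and> 0 \<le> D \<and> (D = 0 \<longrightarrow> P = ?T))" if f: "feas p P" for p P
  proof (cases "\<exists>x y. 0 < p $ x * P $ x $ y \<and> P0 $ x $ y = 0")
    case True
    then show ?thesis
      by (simp add: obj_def KL_rate_def)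
  next
    case False
    obtain R where R: "stochastic R" "P = controlled R Q0" and p: "invariant P p"
      using f by (auto simp: feas_def)
    have P: "stochastic P"
      unfolding R(2) by (intro stochastic_controlled R(1) Q0)
    have pnn: "0 \<le> p $ x" for x
      using p by (intro prob_vec_nonneg) (simp add: invariant_def)
    have ac: "0 < P0 $ x $ y" if "0 < p $ x" "0 < P $ x $ y" for x y
    proof -
      have "P0 $ x $ y \<noteq> 0"
        using False mult_pos_pos[OF that] by blast
      then show ?thesis
        using P0_nonneg[of x y] by simp
    qed
    let ?D = "\<Sum>x\<in>UNIV. p $ x * KL_div (P $ x) (?T $ x)"
    have nn: "0 \<le> p $ x * KL_div (P $ x) (?T $ x)" for x
    proof (cases "p $ x = 0")
      case False
      then show ?thesis
        using ac pnn[of x]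
        by (intro mult_nonneg_nonneg KL_div_nonneg stochasticD P T) (auto simp: TP0)
    qed simp
    have "P = ?T" if "?D = 0"
    proof -
      have row: "P $ x = ?T $ x" if "0 < p $ x" for x
      proof -
        have "\<forall>x\<in>UNIV. p $ x * KL_div (P $ x) (?T $ x) = 0"
          using \<open>?D = 0\<close> by (subst sum_nonneg_eq_0_iff[symmetric]) (simp_all only: finite nn)
        then have "p $ x * KL_div (P $ x) (?T $ x) = 0"
          by blast
        then show ?thesis
          using that ac by (intro KL_div_eq_0_imp stochasticD P T) (auto simp: TP0)
      qed
      \<comment> \<open>Rows agree where \<open>p\<close> is positive, so \<open>p\<close> is
        invariant for \<open>?T\<close> too. Irreducibility of \<open>?T\<close> makes
        \<open>p\<close> positive everywhere, so all rows agree.\<close>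
      have "p v* ?T = p v* P"
        using row pnn unfolding vector_matrix_mult_def vec_eq_iff
        by (auto intro!: sum.cong) (metis less_le)
      then have "invariant ?T p"
        using p by (simp add: invariant_def)
      then show ?thesis
        using row invariant_pos[OF T] by (simp add: vec_eq_iff)
    qed
    moreover have "0 \<le> ?D"
      using nn by (intro sum_nonneg) simp
    moreover have "obj p P = ereal (\<eta> - ?D)"
      unfolding obj_def by (rule objective_eq[OF h R p ac])
    ultimately show ?thesis
      by blast
  qed
  show ?thesis
  proof
    assume "optimal_matrix Q0 P0 U \<zeta> P"
    then obtain p where f: "feas p P" and max: "\<forall>p' P'. feas p' P' \<longrightarrow> obj p' P' \<le> obj p P"
      unfolding opt by blast
    then have "ereal \<eta> \<le> obj p P"
      using feasT objT by metis
    then show "P = ?T"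
      using feas_cases[OF f] by auto
  next
    assume "P = ?T"
    moreover have "obj p' P' \<le> obj ?q ?T" if "feas p' P'" for p' P'
      using feas_cases[OF that] by (auto simp: objT)
    ultimately show "optimal_matrix Q0 P0 U \<zeta> P"
      unfolding opt using feasT by blast
  qed
qed

end

theorem theorem3p5:
  fixes R0 :: "real ^ 'u::finite ^ ('u \<times> 'n::finite)"
    and Q0 :: "real ^ 'n ^ ('u \<times> 'n)"
    and P0 :: "real ^ ('u \<times> 'n) ^ ('u \<times> 'n)"
    and U :: "real ^ ('u \<times> 'n)"
    and x0 :: "'u \<times> 'n"
  assumes "stochastic Q0"
    and "stochastic R0"
    and "P0 = controlled R0 Q0"
    and "irreducible_matrix P0"
    and "aperiodic_matrix P0"
  shows "(\<exists>!h. ode_solution Q0 P0 U x0 h) \<and>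
    (\<forall>h. ode_solution Q0 P0 U x0 h \<longrightarrow>
      (\<forall>\<zeta>. (\<forall>g. (\<exists>\<eta>. relative_value R0 Q0 U x0 \<zeta> g \<eta>) \<longleftrightarrow> g = h \<zeta>) \<and>
           (\<forall>P. optimal_matrix Q0 P0 U \<zeta> P \<longleftrightarrow> P = tilted Q0 P0 (h \<zeta>))))"
proof -
  interpret kl_control R0 Q0 P0
    using assms by unfold_locales
  have rv: "relative_value R0 Q0 U x0 \<zeta> g \<eta> \<longleftrightarrow> g $ x0 = 0 \<and> g - Lam g + \<eta> *\<^sub>R 1 = \<zeta> *\<^sub>R U" for \<zeta> g \<eta>
    unfolding relative_value_iff by (auto simp: algebra_simps)
  have main: "((\<exists>\<eta>. relative_value R0 Q0 U x0 \<zeta> g \<eta>) \<longleftrightarrow> g = h \<zeta>) \<and>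
      (optimal_matrix Q0 P0 U \<zeta> P \<longleftrightarrow> P = tilted Q0 P0 (h \<zeta>))"
    if ode: "ode_solution Q0 P0 U x0 h" for h \<zeta> g P
  proof -
    note base = ode_solution_imp_eigenvector(1)[OF ode, of \<zeta>]
    obtain \<eta> where \<eta>: "h \<zeta> - Lam (h \<zeta>) + \<eta> *\<^sub>R 1 = \<zeta> *\<^sub>R U"
      using ode_solution_imp_eigenvector(2)[OF ode] by blast
    have "g = h \<zeta>" if "relative_value R0 Q0 U x0 \<zeta> g \<eta>'" for \<eta>'
      using that base \<eta> eigenvector_unique(2)[of g \<eta>' "\<zeta> *\<^sub>R U" "h \<zeta>" \<eta> x0] by (simp add: rv)
    then show ?thesis
      using optimal_matrix_iff[OF \<eta>] base \<eta> rv by blast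
  qed
  \<comment> \<open>Uniqueness for the differential equation needs no Lipschitz estimate: at each
    time both solutions equal the unique relative value function.\<close>
  have "h1 = h2" if "ode_solution Q0 P0 U x0 h1" "ode_solution Q0 P0 U x0 h2" for h1 h2
    using main[OF that(1)] main[OF that(2)] by (metis ext)
  with ode_solution_exists main show ?thesis
    by blast
qed

end
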